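(* Let $n>1$, $d>1$ be integers, let $P\in\mathbb{E}=\mathbb{R}[X_1,\dots,X_n]_d$, and assume that the distance $\mathrm{dist}(P,\Delta)$ between $P$ and the real discriminant is nonzero. Then the distance (measured as an arc length on the sphere) between two distinct connected components of the zero level of $P$ in $\mathcal{S}^{n-1}$ is greater than or equal to $$\alpha=\frac2d\sqrt{\frac{2\,\mathrm{dist}(P,\Delta)}{\|P\|}}.$$
   Context: $\mathcal{S}^{n-1}$ is the unit sphere of $\mathbb{R}^n$. $\|P\|$ is the Bombieri norm on $\mathbb{E}$, the norm of the scalar product for which distinct monomials are orthogonal and $\|x^\alpha\|^2=\alpha!/d!$ for $|\alpha|=d$ (where $\alpha!=\prod_i\alpha_i!$). The real discriminant $\Delta\subset\mathbb{E}$ is the set of $Q\in\mathbb{E}$ for which there is $x\in\mathcal{S}^{n-1}$ with $Q(x)=0$ and $\nabla Q(x)=0$; $\mathrm{dist}(P,\Delta)$ is the distance for the Bombieri norm. *)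

theory Defs
  imports "HOL-Analysis.Analysis" "HOL-Library.Poly_Mapping"
begin

(* A monomial in the variables X_i (i ranging over the finite type 'n) is given by its
   exponent vector, and a polynomial maps the exponent vectors to its coefficients. *)

type_synonym 'n real_mpoly = "('n \<Rightarrow>\<^sub>0 nat) \<Rightarrow>\<^sub>0 real"

definition exponents :: "nat \<Rightarrow> ('n::finite \<Rightarrow>\<^sub>0 nat) set" where
  "exponents d = {\<alpha>. (\<Sum>i\<in>UNIV. Poly_Mapping.lookup \<alpha> i) = d}"

definition forms :: "nat \<Rightarrow> 'n::finite real_mpoly set" where
  "forms d = {P. Poly_Mapping.keys P \<subseteq> exponents d}"

definition eval_poly :: "'n::finite real_mpoly \<Rightarrow> real ^ 'n \<Rightarrow> real" where
  "eval_poly P x =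
     (\<Sum>\<alpha>\<in>Poly_Mapping.keys P.
        Poly_Mapping.lookup P \<alpha> * (\<Prod>i\<in>UNIV. (x $ i) ^ Poly_Mapping.lookup \<alpha> i))"

definition bombieri_inner :: "nat \<Rightarrow> 'n::finite real_mpoly \<Rightarrow> 'n real_mpoly \<Rightarrow> real" where
  "bombieri_inner d P Q =
     (\<Sum>\<alpha>\<in>exponents d.
        (\<Prod>i\<in>UNIV. fact (Poly_Mapping.lookup \<alpha> i)) / fact d *
        (Poly_Mapping.lookup P \<alpha> * Poly_Mapping.lookup Q \<alpha>))"

definition bombieri_norm :: "nat \<Rightarrow> 'n::finite real_mpoly \<Rightarrow> real" where
  "bombieri_norm d P = sqrt (bombieri_inner d P P)"

definition real_discriminant :: "nat \<Rightarrow> 'n::finite real_mpoly set" where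
  "real_discriminant d =
     {Q \<in> forms d. \<exists>x\<in>sphere 0 1. eval_poly Q x = 0 \<and> (GDERIV (eval_poly Q) x :> 0)}"

(* The infimum is over a nonempty set, since the zero form lies in the discriminant. *)

definition dist_discriminant :: "nat \<Rightarrow> 'n::finite real_mpoly \<Rightarrow> real" where
  "dist_discriminant d P = (INF Q\<in>real_discriminant d. bombieri_norm d (P - Q))"

(* Length of a shortest great-circle arc from x to y, for unit vectors x and y;
   see sphere_dist_great_circle below. *)

definition sphere_dist :: "'a::real_inner \<Rightarrow> 'a \<Rightarrow> real" where
  "sphere_dist x y = arccos (x \<bullet> y)"

definition sphere_setdist :: "'a::real_inner set \<Rightarrow> 'a set \<Rightarrow> real" where
  "sphere_setdist A B = (INF (x, y)\<in>A \<times> B. sphere_dist x y)"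

definition zero_level :: "'n::finite real_mpoly \<Rightarrow> (real ^ 'n) set" where
  "zero_level P = {x \<in> sphere 0 1. eval_poly P x = 0}"

lemma finite_exponents: "finite (exponents d :: ('n::finite \<Rightarrow>\<^sub>0 nat) set)"
proof (rule finite_imageD)
  have "Poly_Mapping.lookup ` (exponents d :: ('n \<Rightarrow>\<^sub>0 nat) set) \<subseteq> (PiE UNIV (\<lambda>_. {..d}))"
  proof clarify
    fix \<alpha> :: "'n \<Rightarrow>\<^sub>0 nat"
    assume "\<alpha> \<in> exponents d"
    then have "Poly_Mapping.lookup \<alpha> i \<le> d" for i
      using member_le_sum[of i UNIV "Poly_Mapping.lookup \<alpha>"] by (simp add: exponents_def)
    then show "Poly_Mapping.lookup \<alpha> \<in> (PiE UNIV (\<lambda>_. {..d}))"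
      by (simp add: PiE_UNIV_domain)
  qed
  then show "finite (Poly_Mapping.lookup ` (exponents d :: ('n \<Rightarrow>\<^sub>0 nat) set))"
    by (rule finite_subset) (simp add: finite_PiE)
  show "inj_on Poly_Mapping.lookup (exponents d :: ('n \<Rightarrow>\<^sub>0 nat) set)"
    by (simp add: inj_on_def lookup_inject)
qed

lemma bombieri_inner_monomials:
  fixes \<alpha> \<beta> :: "'n::finite \<Rightarrow>\<^sub>0 nat"
  assumes "\<alpha> \<in> exponents d" "\<beta> \<in> exponents d"
  shows "bombieri_inner d (Poly_Mapping.single \<alpha> 1) (Poly_Mapping.single \<beta> 1) =
    (if \<alpha> = \<beta> then (\<Prod>i\<in>UNIV. fact (Poly_Mapping.lookup \<alpha> i)) / fact d else 0)"
proof -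
  have "bombieri_inner d (Poly_Mapping.single \<alpha> 1) (Poly_Mapping.single \<beta> 1) =
    (\<Sum>\<gamma>\<in>exponents d. if \<gamma> = \<alpha>
        then (if \<alpha> = \<beta> then (\<Prod>i\<in>UNIV. fact (Poly_Mapping.lookup \<alpha> i)) / fact d else 0) else 0)"
    unfolding bombieri_inner_def
    by (intro sum.cong) (auto simp: lookup_single when_def)
  then show ?thesis
    using assms by (simp add: finite_exponents)
qed

lemma zero_in_real_discriminant: "(0 :: 'n::finite real_mpoly) \<in> real_discriminant d"
proof -
  have "eval_poly (0 :: 'n real_mpoly) = (\<lambda>_. 0)"
    by (simp add: eval_poly_def fun_eq_iff)
  then show ?thesis
    unfolding real_discriminant_def forms_def
    using vector_choose_size[of 1, where 'a = "real ^ 'n"] by (auto simp: GDERIV_const)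
qed

lemma sphere_dist_great_circle:
  fixes x v :: "'a::real_inner"
  assumes "norm x = 1" "norm v = 1" "x \<bullet> v = 0" "0 \<le> t" "t \<le> pi"
  shows "sphere_dist x (cos t *\<^sub>R x + sin t *\<^sub>R v) = t"
  using assms
  by (simp add: sphere_dist_def inner_add_right dot_square_norm arccos_cos)

end

theory Submission
  imports Defs
begin

text \<open>Let $x, y$ be zeros of $P$ on the sphere at arc distance $\theta$. Along the great circle
from $x$ to $y$ the second derivative of $P$ is at most $d^2 \|P\|$, so $|P| \le M = d^2 \|P\|
\theta^2/8$ on the arc. If $\theta < \alpha$, then $M < \mathrm{dist}(P, \Delta)$, and then $P$ has no
critical point on the sphere with $|P| \le M$, since a critical point $z$ gives the element
$P - P(z) \langle z, \cdot \rangle^d$ of $\Delta$ at distance $|P(z)|$ from $P$. Hence moving along the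
tangential gradient with a step proportional to $-P$ shrinks $|P|$ by a constant factor on
$\{|P| \le M\}$ and fixes the zeros. The iterates carry the arc to connected sets through $x$ and $y$ on
which $P$ tends uniformly to $0$, so $x$ and $y$ lie in one component of the zero level.\<close>

section \<open>Monomials and the Bombieri norm\<close>

lemma finite_bounded_sum_functions:
  assumes "finite A"
  shows "finite {a :: 'a \<Rightarrow> nat. (\<forall>i. i \<notin> A \<longrightarrow> a i = 0) \<and> sum a A = d}"
proof (rule finite_subset)
  show "{a :: 'a \<Rightarrow> nat. (\<forall>i. i \<notin> A \<longrightarrow> a i = 0) \<and> sum a A = d} \<subseteq>
      {a. \<forall>i. (i \<in> A \<longrightarrow> a i \<in> {..d}) \<and> (i \<notin> A \<longrightarrow> a i = 0)}"
    using assms by (auto intro: member_le_sum)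
  show "finite {a. \<forall>i. (i \<in> A \<longrightarrow> a i \<in> {..d}) \<and> (i \<notin> A \<longrightarrow> a i = 0)}"
    using assms by (intro finite_set_of_finite_funs) auto
qed

text \<open>Splitting off the exponent of \<open>j\<close> leaves the sum over \<open>A\<close> of
  complementary degree. Dividing by factorials makes the resulting convolution exactly the one that
  \<open>exp_series_add_commuting\<close> evaluates. Requiring \<open>a i = 0\<close> outside
  \<open>A\<close> keeps the index set finite.\<close>

lemma multinomial_theorem:
  fixes z :: "'a \<Rightarrow> real"
  assumes "finite A"
  shows "(\<Sum>a | (\<forall>i. i \<notin> A \<longrightarrow> a i = 0) \<and> sum a A = d. \<Prod>i\<in>A. z i ^ a i / fact (a i)) =
    (\<Sum>i\<in>A. z i) ^ d / fact d"
  using assms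
proof (induction A arbitrary: d)
  case empty
  have "{a :: 'a \<Rightarrow> nat. (\<forall>i. a i = 0) \<and> d = 0} = (if d = 0 then {\<lambda>_. 0} else {})"
    by auto
  then show ?case by (simp add: power_0_left)
next
  case (insert j A)
  let ?T = "\<lambda>A d. {a :: 'a \<Rightarrow> nat. (\<forall>i. i \<notin> A \<longrightarrow> a i = 0) \<and> sum a A = d}"
  let ?m = "\<lambda>A a. \<Prod>i\<in>A. z i ^ a i / fact (a i)"
  have sum_upd: "sum (b(j := k)) A = sum b A" and prod_upd: "?m A (b(j := k)) = ?m A b" for b k
    using insert.hyps by (auto intro!: sum.cong prod.cong)
  have "sum (?m (insert j A)) (?T (insert j A) d) =
      (\<Sum>(k, b) \<in> (SIGMA k:{..d}. ?T A (d - k)). z j ^ k / fact k * ?m A b)"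
    by (rule sum.reindex_bij_witness[of _ "\<lambda>(k, b). b(j := k)" "\<lambda>a. (a j, a(j := 0))"])
       (use insert.hyps sum_upd prod_upd in auto)
  also have "\<dots> = (\<Sum>k\<le>d. z j ^ k / fact k * sum (?m A) (?T A (d - k)))"
    by (subst sum.Sigma[symmetric])
       (auto simp: sum_distrib_left finite_bounded_sum_functions insert.hyps(1))
  also have "\<dots> = (\<Sum>k\<le>d. z j ^ k /\<^sub>R fact k * ((\<Sum>i\<in>A. z i) ^ (d - k) /\<^sub>R fact (d - k)))"
    unfolding insert.IH by (simp add: field_simps)
  also have "\<dots> = (z j + (\<Sum>i\<in>A. z i)) ^ d /\<^sub>R fact d"
    by (rule exp_series_add_commuting[symmetric]) simp
  finally show ?case
    using insert.hyps by (simp add: divide_inverse mult_ac)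
qed

definition monomial_value :: "('n::finite \<Rightarrow>\<^sub>0 nat) \<Rightarrow> real ^ 'n \<Rightarrow> real" where
  "monomial_value \<alpha> x = (\<Prod>i\<in>UNIV. (x $ i) ^ Poly_Mapping.lookup \<alpha> i)"

text \<open>For an exponent vector of degree \<open>d\<close> this is both the reciprocal of the
  squared Bombieri norm of the monomial and its coefficient in the d-th power of the sum of the
  variables. This coincidence makes the reproducing kernel a power of the scalar product.\<close>

definition multinomial_coeff :: "nat \<Rightarrow> ('n::finite \<Rightarrow>\<^sub>0 nat) \<Rightarrow> real" where
  "multinomial_coeff d \<alpha> = fact d / (\<Prod>i\<in>UNIV. fact (Poly_Mapping.lookup \<alpha> i))"

lemma multinomial_coeff_pos: "multinomial_coeff d \<alpha> > 0"
  by (simp add: multinomial_coeff_def prod_pos)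

text \<open>Evaluation at $x$ is the Bombieri scalar product with $\langle x, \cdot \rangle^d$.\<close>

lemma reproducing_kernel:
  fixes x y :: "real ^ 'n::finite"
  shows "(\<Sum>\<alpha>\<in>exponents d. multinomial_coeff d \<alpha> * (monomial_value \<alpha> x * monomial_value \<alpha> y)) =
    (x \<bullet> y) ^ d"
proof -
  have "(\<Sum>\<alpha>\<in>exponents d. multinomial_coeff d \<alpha> * (monomial_value \<alpha> x * monomial_value \<alpha> y)) =
     (\<Sum>a | (\<forall>i. i \<notin> (UNIV::'n set) \<longrightarrow> a i = 0) \<and> sum a (UNIV::'n set) = d.
       fact d * (\<Prod>i\<in>UNIV. (x $ i * y $ i) ^ a i / fact (a i)))"
    by (rule sum.reindex_bij_witness[of _ "Abs_poly_mapping" "Poly_Mapping.lookup"])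
       (auto simp: exponents_def multinomial_coeff_def monomial_value_def power_mult_distrib
         prod_dividef prod.distrib Abs_poly_mapping_inverse)
  also have "\<dots> = (x \<bullet> y) ^ d"
    unfolding sum_distrib_left[symmetric] by (subst multinomial_theorem) (simp_all add: inner_vec_def)
  finally show ?thesis .
qed

lemma eval_poly_form:
  assumes "P \<in> forms d"
  shows "eval_poly P x = (\<Sum>\<alpha>\<in>exponents d. Poly_Mapping.lookup P \<alpha> * monomial_value \<alpha> x)"
  unfolding eval_poly_def monomial_value_def
  using assms by (intro sum.mono_neutral_left) (auto simp: forms_def finite_exponents in_keys_iff)

lemma bombieri_inner_eq:
  "bombieri_inner d P Q =
    (\<Sum>\<alpha>\<in>exponents d. Poly_Mapping.lookup P \<alpha> * Poly_Mapping.lookup Q \<alpha> / multinomial_coeff d \<alpha>)"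
  by (simp add: bombieri_inner_def multinomial_coeff_def mult.commute)

lemma bombieri_inner_self_nonneg: "bombieri_inner d P P \<ge> 0"
  unfolding bombieri_inner_eq by (intro sum_nonneg divide_nonneg_pos multinomial_coeff_pos) simp

lemma bombieri_norm_nonneg: "bombieri_norm d P \<ge> 0"
  by (simp add: bombieri_norm_def bombieri_inner_self_nonneg)

text \<open>The ordinary Cauchy-Schwarz inequality after moving the square root of the weight from
  one factor to the other. It bounds any linear functional of the coefficients, in particular a
  second derivative along a curve.\<close>

lemma bombieri_cauchy_schwarz:
  "\<bar>\<Sum>\<alpha>\<in>exponents d. Poly_Mapping.lookup P \<alpha> * u \<alpha>\<bar> \<le>
     bombieri_norm d P * sqrt (\<Sum>\<alpha>\<in>exponents d. multinomial_coeff d \<alpha> * (u \<alpha>)\<^sup>2)"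
proof -
  let ?c = "multinomial_coeff d" and ?p = "Poly_Mapping.lookup P"
  have "(\<Sum>\<alpha>\<in>exponents d. ?p \<alpha> * u \<alpha>)\<^sup>2 =
      (\<Sum>\<alpha>\<in>exponents d. (?p \<alpha> / sqrt (?c \<alpha>)) * (sqrt (?c \<alpha>) * u \<alpha>))\<^sup>2"
    using multinomial_coeff_pos[of d] by (intro arg_cong[where f = "\<lambda>s. s\<^sup>2"] sum.cong)
      (auto simp: less_le)
  also have "\<dots> \<le> (\<Sum>\<alpha>\<in>exponents d. (?p \<alpha> / sqrt (?c \<alpha>))\<^sup>2) * (\<Sum>\<alpha>\<in>exponents d. (sqrt (?c \<alpha>) * u \<alpha>)\<^sup>2)"
    by (rule Cauchy_Schwarz_ineq_sum)
  also have "\<dots> = bombieri_inner d P P * (\<Sum>\<alpha>\<in>exponents d. ?c \<alpha> * (u \<alpha>)\<^sup>2)"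
    by (simp add: bombieri_inner_eq power_divide power_mult_distrib multinomial_coeff_pos[THEN less_imp_le]
        flip: power2_eq_square)
  finally show ?thesis
    unfolding bombieri_norm_def by (simp add: real_le_rsqrt flip: real_sqrt_mult)
qed

lemma forms_diff: "P \<in> forms d \<Longrightarrow> Q \<in> forms d \<Longrightarrow> P - Q \<in> forms d"
  unfolding forms_def using keys_diff[of P Q] by blast

lemma eval_poly_diff:
  assumes "P \<in> forms d" "Q \<in> forms d"
  shows "eval_poly (P - Q) x = eval_poly P x - eval_poly Q x"
  using assms
  by (simp add: eval_poly_form[of _ d] forms_diff lookup_minus left_diff_distrib sum_subtractf)

text \<open>The form \<open>c * (z \<bullet> x) ^ d\<close> in the variable \<open>x\<close>,
  written through its multinomial expansion.\<close>

definition power_form :: "nat \<Rightarrow> real \<Rightarrow> real ^ 'n \<Rightarrow> 'n::finite real_mpoly" where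
  "power_form d c z = Abs_poly_mapping
     (\<lambda>\<alpha>. if \<alpha> \<in> exponents d then c * (multinomial_coeff d \<alpha> * monomial_value \<alpha> z) else 0)"

lemma lookup_power_form:
  "Poly_Mapping.lookup (power_form d c z) \<alpha> =
    (if \<alpha> \<in> exponents d then c * (multinomial_coeff d \<alpha> * monomial_value \<alpha> z) else 0)"
proof -
  have "finite {\<alpha>. (if \<alpha> \<in> exponents d then c * (multinomial_coeff d \<alpha> * monomial_value \<alpha> z) else 0) \<noteq> 0}"
    by (rule finite_subset[OF _ finite_exponents[of d]]) auto
  then show ?thesis
    by (simp add: power_form_def Abs_poly_mapping_inverse)
qed

lemma power_form_in_forms: "power_form d c z \<in> forms d"
  by (auto simp: forms_def in_keys_iff lookup_power_form split: if_splits)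

lemma eval_power_form: "eval_poly (power_form d c z) x = c * (z \<bullet> x) ^ d"
  by (simp add: eval_poly_form[OF power_form_in_forms] lookup_power_form mult.assoc
      reproducing_kernel flip: sum_distrib_left)

text \<open>The Bombieri weight cancels one multinomial coefficient, and the kernel at the pair
  \<open>z\<close>, \<open>z\<close> remains. For a unit vector \<open>z\<close> the norm is just
  the absolute value of \<open>c\<close>.\<close>

lemma bombieri_norm_power_form: "bombieri_norm d (power_form d c z) = \<bar>c\<bar> * norm z ^ d"
proof -
  have "bombieri_inner d (power_form d c z) (power_form d c z) =
      (\<Sum>\<alpha>\<in>exponents d. c\<^sup>2 * (multinomial_coeff d \<alpha> * (monomial_value \<alpha> z * monomial_value \<alpha> z)))"
    unfolding bombieri_inner_eq using multinomial_coeff_pos[of d]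
    by (intro sum.cong) (auto simp: lookup_power_form power2_eq_square field_simps less_le)
  also have "\<dots> = (\<bar>c\<bar> * norm z ^ d)\<^sup>2"
    by (simp add: reproducing_kernel power_mult_distrib dot_square_norm power_mult[symmetric] mult.commute flip: sum_distrib_left)
  finally show ?thesis
    by (simp add: bombieri_norm_def)
qed

section \<open>Zeros joined by iterating a contracting map\<close>

text \<open>The iterates of \<open>\<phi>\<close> need not converge, so no limit of the images of
  \<open>S\<close> is taken. The images only show that \<open>x\<close> and \<open>y\<close> share a
  component of each compact sublevel set; the nested intersection of these components is connected,
  and \<open>p\<close> vanishes on it.\<close>

lemma contracting_map_joins_zeros:
  fixes p :: "'a::euclidean_space \<Rightarrow> real"
  assumes K: "compact K" and contp: "continuous_on K p"
    and cont: "continuous_on K \<phi>" and into: "\<phi> ` K \<subseteq> K"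
    and fixed: "\<And>z. z \<in> K \<Longrightarrow> p z = 0 \<Longrightarrow> \<phi> z = z"
    and contract: "\<And>z. z \<in> K \<Longrightarrow> \<bar>p (\<phi> z)\<bar> \<le> q * \<bar>p z\<bar>" and q: "0 \<le> q" "q < 1"
    and S: "connected S" "S \<subseteq> K" "x \<in> S" "y \<in> S" and zeros: "p x = 0" "p y = 0"
  obtains T where "connected T" "T \<subseteq> {z \<in> K. p z = 0}" "x \<in> T" "y \<in> T"
proof -
  obtain M where M: "\<And>z. z \<in> K \<Longrightarrow> \<bar>p z\<bar> \<le> M"
    using compact_imp_bounded[OF compact_continuous_image[OF contp K]]
    by (auto simp: bounded_iff)
  have "0 \<le> M"
    using M[of x] S by force
  define L where "L n = {z \<in> K. p z \<in> {-(q ^ n * M)..q ^ n * M}}" for n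
  \<comment> \<open>The images of \<open>S\<close> need not be nested, but the components of
    \<open>x\<close> in the decreasing sets \<open>L n\<close> are, as \<open>connected_nest\<close>
    requires.\<close>
  define Y where "Y n = connected_component_set (L n) x" for n
  have L_iff: "z \<in> L n \<longleftrightarrow> z \<in> K \<and> \<bar>p z\<bar> \<le> q ^ n * M" for n z
    by (auto simp: L_def)
  have L_compact: "compact (L n)" for n
  proof -
    have "L n = K \<inter> p -` {-(q ^ n * M)..q ^ n * M}"
      by (auto simp: L_def)
    then show ?thesis
      using closedin_compact[OF K] continuous_closedin_preimage[OF contp] by simp
  qed
  have L_decreasing: "L n \<subseteq> L m" if "m \<le> n" for m n
  proof -
    have "q ^ n * M \<le> q ^ m * M"
      using power_decreasing[OF that q(1)] q \<open>0 \<le> M\<close> by (auto intro: mult_right_mono)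
    then show ?thesis
      by (auto simp: L_iff)
  qed
  \<comment> \<open>\<open>M\<close> bounds \<open>p\<close> on all of \<open>K\<close>, so
    \<open>S\<close> starts inside \<open>L 0\<close>; each application of \<open>\<phi>\<close>
    gains a factor \<open>q\<close>.\<close>
  have iterate: "connected ((\<phi> ^^ n) ` S) \<and> (\<phi> ^^ n) ` S \<subseteq> L n" for n
  proof (induction n)
    case 0
    then show ?case using S M by (auto simp: L_iff)
  next
    case (Suc n)
    have sub: "(\<phi> ^^ n) ` S \<subseteq> K"
      using Suc by (auto simp: L_iff)
    have "connected (\<phi> ` ((\<phi> ^^ n) ` S))"
      using Suc connected_continuous_image[OF continuous_on_subset[OF cont sub]] by blast
    moreover have "\<phi> z \<in> L (Suc n)" if "z \<in> L n" for z
      using that into contract[of z] mult_left_mono[of "\<bar>p z\<bar>" "q ^ n * M" q] q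
      by (auto simp: L_iff)
    ultimately show ?case
      using Suc by (auto simp: image_comp)
  qed
  have fixed_iterate: "(\<phi> ^^ n) x = x" "(\<phi> ^^ n) y = y" for n
    using fixed zeros S by (induction n) auto
  have joined: "connected_component (L n) x y" for n
    unfolding connected_component_def
    using iterate[of n] fixed_iterate[of n] S by (metis imageI)
  have "connected (\<Inter> (range Y))"
  proof (rule connected_nest)
    show "compact (Y n)" for n
      unfolding Y_def using L_compact
      by (metis compact_eq_bounded_closed bounded_subset closed_connected_component connected_component_subset)
    show "Y n \<subseteq> Y m" if "m \<le> n" for m n
      unfolding Y_def using L_decreasing[OF that] by (rule connected_component_mono)
  qed (simp add: Y_def)
  moreover have "\<Inter> (range Y) \<subseteq> {z \<in> K. p z = 0}"
  proof
    fix z assume "z \<in> \<Inter> (range Y)"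
    then have "z \<in> L n" for n
      unfolding Y_def using connected_component_subset by fastforce
    moreover have "(\<lambda>n. q ^ n * M) \<longlonglongrightarrow> 0"
      using q by (auto intro!: tendsto_mult_left_zero LIMSEQ_power_zero)
    ultimately have "\<bar>p z\<bar> \<le> 0"
      by (intro LIMSEQ_le_const[where X = "\<lambda>n. q ^ n * M"]) (auto simp: L_iff)
    then show "z \<in> {z \<in> K. p z = 0}"
      using \<open>\<And>n. z \<in> L n\<close> by (auto simp: L_iff)
  qed
  moreover have "x \<in> \<Inter> (range Y)" "y \<in> \<Inter> (range Y)"
    using joined connected_component_in[OF joined] by (auto simp: Y_def connected_component_refl_eq)
  ultimately show ?thesis
    using that by blast
qed

section \<open>Bounds in one real variable from the second derivative\<close>

lemma vanishing_at_endpoints_bound: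
  fixes f :: "real \<Rightarrow> real"
  assumes f': "\<And>t. (f has_real_derivative f' t) (at t)"
    and f'': "\<And>t. (f' has_real_derivative f'' t) (at t)"
    and bound: "\<And>t. \<bar>f'' t\<bar> \<le> K" and zeros: "f 0 = 0" "f \<theta> = 0" and t: "0 \<le> t" "t \<le> \<theta>"
  shows "\<bar>f t\<bar> \<le> K * \<theta>\<^sup>2 / 8"
proof -
  have *: "g t \<le> K * \<theta>\<^sup>2 / 8"
    if g': "\<And>t. (g has_real_derivative g' t) (at t)"
    and g'': "\<And>t. (g' has_real_derivative g'' t) (at t)"
    and bound: "\<And>t. \<bar>g'' t\<bar> \<le> K" and zeros: "g 0 = 0" "g \<theta> = 0" for g g' g'' :: "real \<Rightarrow> real"
  proof -
    \<comment> \<open>The added parabola makes the function convex, hence at most its chord over the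
      interval from 0 to \<open>\<theta>\<close>. Removing the parabola leaves
      \<open>g t \<le> K * (t * (\<theta> - t)) / 2\<close>.\<close>
    define h where "h s = g s + K * s\<^sup>2 / 2" for s
    have "convex_on UNIV h"
    proof (rule f''_ge0_imp_convex)
      show "(h has_real_derivative g' s + K * s) (at s)" for s
        unfolding h_def by (auto intro!: derivative_eq_intros g')
      show "((\<lambda>s. g' s + K * s) has_real_derivative g'' s + K) (at s)" for s
        by (auto intro!: derivative_eq_intros g'')
      show "0 \<le> g'' s + K" for s
        using bound[of s] by linarith
    qed simp
    show ?thesis
    proof (cases "\<theta> = 0")
      case True
      then show ?thesis using t zeros by simp
    next
      case False
      with t have "\<theta> > 0" by simp
      have "h ((1 - t / \<theta>) *\<^sub>R 0 + (t / \<theta>) *\<^sub>R \<theta>) \<le> (1 - t / \<theta>) * h 0 + (t / \<theta>) * h \<theta>"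
        using \<open>convex_on UNIV h\<close> by (rule convex_onD) (use t \<open>\<theta> > 0\<close> in auto)
      then have "g t \<le> K * (t * (\<theta> - t)) / 2"
        using zeros \<open>\<theta> > 0\<close> by (simp add: h_def power2_eq_square algebra_simps)
      \<comment> \<open>The maximum, attained at the midpoint, produces the constant 8. The sign of
        \<open>K\<close> needed to multiply by it comes from \<open>bound[of 0]\<close>.\<close>
      also have "t * (\<theta> - t) \<le> \<theta>\<^sup>2 / 4"
        using zero_le_power2[of "t - \<theta> / 2"] by (simp add: power2_eq_square algebra_simps)
      then have "K * (t * (\<theta> - t)) / 2 \<le> K * (\<theta>\<^sup>2 / 4) / 2"
        using bound[of 0] by (intro divide_right_mono mult_left_mono) auto
      finally show ?thesis by simp
    qed
  qed
  have "f t \<le> K * \<theta>\<^sup>2 / 8"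
    using f' f'' bound zeros by (rule *)
  moreover have "- f t \<le> K * \<theta>\<^sup>2 / 8"
    by (rule *[of "\<lambda>t. - f t" "\<lambda>t. - f' t" "\<lambda>t. - f'' t"])
       (auto intro!: derivative_eq_intros f' f'' bound simp: zeros)
  ultimately show ?thesis by linarith
qed

text \<open>Taylor's formula with Lagrange remainder. Both signs of \<open>t\<close> are covered
  because the descent step has the sign opposite to that of the polynomial.\<close>

lemma linear_approximation_bound:
  fixes f :: "real \<Rightarrow> real"
  assumes f': "\<And>t. (f has_real_derivative f' t) (at t)"
    and f'': "\<And>t. (f' has_real_derivative f'' t) (at t)"
    and bound: "\<And>t. \<bar>f'' t\<bar> \<le> K"
  shows "\<bar>f t - f 0 - t * f' 0\<bar> \<le> K * t\<^sup>2 / 2"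
proof (cases "t = 0")
  case False
  \<comment> \<open>\<open>Taylor\<close> expects a derivative for every order; only orders 0 to 2
    matter here, and higher ones get \<open>f''\<close> as a default.\<close>
  define diff where "diff m = (if m = 0 then f else if m = 1 then f' else f'')" for m :: nat
  have "\<exists>s. (if t < 0 then t < s \<and> s < 0 else 0 < s \<and> s < t) \<and>
      f t = (\<Sum>m<2. diff m 0 / fact m * (t - 0) ^ m) + diff 2 s / fact 2 * (t - 0) ^ 2"
    by (rule Taylor[where a = "- \<bar>t\<bar>" and b = "\<bar>t\<bar>"])
       (use False in \<open>auto simp: diff_def f' f'' less_2_cases_iff\<close>)
  then obtain s where "f t = f 0 + f' 0 * t + f'' s / 2 * t\<^sup>2"
    by (auto simp: diff_def numeral_2_eq_2)
  then have "\<bar>f t - f 0 - t * f' 0\<bar> = \<bar>f'' s\<bar> * t\<^sup>2 / 2"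
    by (simp add: abs_mult)
  also have "\<dots> \<le> K * t\<^sup>2 / 2"
    using bound[of s] by (intro divide_right_mono mult_right_mono) auto
  finally show ?thesis .
qed simp

section \<open>Great circles\<close>

text \<open>The direction \<open>v\<close> is the normalised part of \<open>y\<close> orthogonal to
  \<open>x\<close>, whose length is the sine of the angle.\<close>

lemma great_circle_through:
  fixes x y :: "'a::euclidean_space"
  assumes "DIM('a) \<ge> 2" and x: "norm x = 1" and y: "norm y = 1"
  obtains v where "norm v = 1" "x \<bullet> v = 0"
    "y = cos (sphere_dist x y) *\<^sub>R x + sin (sphere_dist x y) *\<^sub>R v"
proof -
  define w where "w = y - (x \<bullet> y) *\<^sub>R x"
  have le: "\<bar>x \<bullet> y\<bar> \<le> 1"
    using Cauchy_Schwarz_ineq2[of x y] x y by simp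
  then have cos: "cos (sphere_dist x y) = x \<bullet> y"
    and sin: "sin (sphere_dist x y) = sqrt (1 - (x \<bullet> y)\<^sup>2)"
    unfolding sphere_dist_def by (auto simp: sin_arccos_abs)
  have orth: "x \<bullet> w = 0"
    using x by (simp add: w_def inner_diff_right dot_square_norm)
  have "x \<bullet> x = 1" "y \<bullet> y = 1"
    using x y by (simp_all add: dot_square_norm)
  then have "w \<bullet> w = 1 - (x \<bullet> y)\<^sup>2"
    by (simp add: w_def inner_diff inner_commute power2_eq_square)
  then have norm_w: "norm w = sin (sphere_dist x y)"
    by (simp add: norm_eq_sqrt_inner sin)
  show ?thesis
  proof (cases "w = 0")
    case True
    \<comment> \<open>Here \<open>y\<close> is \<open>x\<close> or its antipode and the sine is 0,
      so any unit vector orthogonal to \<open>x\<close> serves. One exists because the dimension is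
      at least 2.\<close>
    obtain v where v: "v \<noteq> 0" "orthogonal x v"
      using orthogonal_to_vector_exists[OF assms(1), of x] by blast
    show ?thesis
    proof
      show "norm (v /\<^sub>R norm v) = 1" "x \<bullet> (v /\<^sub>R norm v) = 0"
        using v by (auto simp: orthogonal_def)
      show "y = cos (sphere_dist x y) *\<^sub>R x + sin (sphere_dist x y) *\<^sub>R (v /\<^sub>R norm v)"
        using True norm_w cos by (simp add: w_def)
    qed
  next
    case False
    show ?thesis
    proof
      show "norm (w /\<^sub>R norm w) = 1" "x \<bullet> (w /\<^sub>R norm w) = 0"
        using False orth by auto
      show "y = cos (sphere_dist x y) *\<^sub>R x + sin (sphere_dist x y) *\<^sub>R (w /\<^sub>R norm w)"
        using False by (simp add: cos w_def flip: norm_w)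
    qed
  qed
qed

lemma norm_great_circle:
  fixes x v :: "'a::real_inner"
  assumes "norm x = 1" "norm v = 1" "x \<bullet> v = 0"
  shows "norm (cos t *\<^sub>R x + sin t *\<^sub>R v) = 1"
proof -
  have "x \<bullet> x = 1" "v \<bullet> v = 1"
    using assms by (simp_all add: dot_square_norm)
  then show ?thesis
    using assms(3)
    by (simp add: norm_eq_sqrt_inner inner_add inner_commute[of v x] flip: power2_eq_square)
qed

section \<open>Second derivatives of a form along a great circle\<close>

definition twice_differentiable :: "(real \<Rightarrow> real) \<Rightarrow> bool" where
  "twice_differentiable f \<longleftrightarrow> (\<exists>f' f''. \<forall>t.
     (f has_real_derivative f' t) (at t) \<and> (f' has_real_derivative f'' t) (at t))"

lemma twice_differentiableI:
  assumes "\<And>t. (f has_real_derivative f' t) (at t)" "\<And>t. (f' has_real_derivative f'' t) (at t)"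
  shows "twice_differentiable f"
  using assms unfolding twice_differentiable_def by blast

lemma twice_differentiable_mult:
  assumes "twice_differentiable f" "twice_differentiable g"
  shows "twice_differentiable (\<lambda>t. f t * g t)"
proof -
  obtain f' f'' where f: "\<And>t. (f has_real_derivative f' t) (at t)"
    "\<And>t. (f' has_real_derivative f'' t) (at t)"
    using assms unfolding twice_differentiable_def by blast
  obtain g' g'' where g: "\<And>t. (g has_real_derivative g' t) (at t)"
    "\<And>t. (g' has_real_derivative g'' t) (at t)"
    using assms unfolding twice_differentiable_def by blast
  show ?thesis
  proof (rule twice_differentiableI)
    show "((\<lambda>t. f t * g t) has_real_derivative f' t * g t + f t * g' t) (at t)" for t
      by (auto intro!: derivative_eq_intros f g)
    show "((\<lambda>t. f' t * g t + f t * g' t) has_real_derivative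
        f'' t * g t + 2 * (f' t * g' t) + f t * g'' t) (at t)" for t
      by (auto intro!: derivative_eq_intros f g)
  qed
qed

lemma twice_differentiable_const: "twice_differentiable (\<lambda>t. c)"
  by (rule twice_differentiableI[where f' = "\<lambda>_. 0" and f'' = "\<lambda>_. 0"]) auto

lemma twice_differentiable_power:
  "twice_differentiable f \<Longrightarrow> twice_differentiable (\<lambda>t. f t ^ k)"
  by (induction k) (simp_all add: twice_differentiable_const twice_differentiable_mult)

lemma twice_differentiable_prod:
  assumes "\<And>i. i \<in> A \<Longrightarrow> twice_differentiable (f i)"
  shows "twice_differentiable (\<lambda>t. \<Prod>i\<in>A. f i t)"
  using assms
  by (induction A rule: infinite_finite_induct)
    (simp_all add: twice_differentiable_const twice_differentiable_mult)

text \<open>Existence is enough: the derivatives of single monomials never have to be computed,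
  since only a weighted sum of squares of the second ones is used, and the kernel determines
  it.\<close>

lemma twice_differentiable_monomial_great_circle:
  "twice_differentiable (\<lambda>t. monomial_value \<alpha> (cos t *\<^sub>R x + sin t *\<^sub>R v))"
proof -
  have "twice_differentiable (\<lambda>t. cos t * x $ i + sin t * v $ i)" for i
    by (rule twice_differentiableI[where f' = "\<lambda>t. - sin t * x $ i + cos t * v $ i"
          and f'' = "\<lambda>t. - cos t * x $ i - sin t * v $ i"])
      (auto intro!: derivative_eq_intros)
  then show ?thesis
    unfolding monomial_value_def by (simp add: twice_differentiable_prod twice_differentiable_power)
qed

lemma cos_power_has_derivative:
  "((\<lambda>t. cos (t - s) ^ k) has_real_derivative - (real k * cos (t - s) ^ (k - 1) * sin (t - s))) (at t)"
  by (auto intro!: derivative_eq_intros)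

text \<open>Replacing the squared sine leaves powers of the cosine only, so the same rule can be
  applied again for the fourth derivative. Truncated subtraction in the exponents is harmless, since
  the factor in front vanishes whenever it occurs.\<close>

lemma cos_power_second_derivative:
  "((\<lambda>t. - (real k * cos (t - s) ^ (k - 1) * sin (t - s))) has_real_derivative
     real k * real (k - 1) * cos (t - s) ^ (k - 2) - (real k)\<^sup>2 * cos (t - s) ^ k) (at t)"
proof -
  have *: "real k * real (k - 1) * (cos (t - s) ^ (k - 2) * (cos (t - s) * cos (t - s))) =
      real k * real (k - 1) * cos (t - s) ^ k"
  proof (cases "k < 2")
    case False
    then have "k = Suc (Suc (k - 2))" by simp
    then have "cos (t - s) ^ k = cos (t - s) * (cos (t - s) * cos (t - s) ^ (k - 2))"
      by (metis power_Suc)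
    then show ?thesis by (simp add: mult_ac)
  qed (auto simp: less_2_cases_iff)
  have **: "real k * (cos (t - s) ^ (k - 1) * cos (t - s)) = real k * cos (t - s) ^ k"
    by (cases k) auto
  have "((\<lambda>t. - (real k * cos (t - s) ^ (k - 1) * sin (t - s))) has_real_derivative
      real k * real (k - 1) * cos (t - s) ^ (k - 2) * (sin (t - s))\<^sup>2
        - real k * (cos (t - s) ^ (k - 1) * cos (t - s))) (at t)"
    by (auto intro!: derivative_eq_intros simp: power2_eq_square diff_diff_eq numeral_2_eq_2)
  also have "real k * real (k - 1) * cos (t - s) ^ (k - 2) * (sin (t - s))\<^sup>2 =
      real k * real (k - 1) * cos (t - s) ^ (k - 2)
        - real k * real (k - 1) * (cos (t - s) ^ (k - 2) * (cos (t - s) * cos (t - s)))"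
    unfolding sin_squared_eq by (simp add: algebra_simps power2_eq_square)
  also have "real k * real (k - 1) * cos (t - s) ^ (k - 2)
        - real k * real (k - 1) * (cos (t - s) ^ (k - 2) * (cos (t - s) * cos (t - s)))
        - real k * (cos (t - s) ^ (k - 1) * cos (t - s)) =
      real k * real (k - 1) * cos (t - s) ^ (k - 2) - (real k)\<^sup>2 * cos (t - s) ^ k"
    unfolding * ** by (cases k) (simp_all add: algebra_simps power2_eq_square)
  finally show ?thesis .
qed

text \<open>The right-hand side is the fourth derivative of $\cos^d$ at $0$, which arises by differentiating
  the kernel twice in $s$ and twice in $t$ and setting $s = t$.\<close>

lemma second_derivative_kernel:
  fixes c :: "'i \<Rightarrow> real"
  assumes m': "\<And>i t. (m i has_real_derivative m' i t) (at t)"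
    and m'': "\<And>i t. (m' i has_real_derivative m'' i t) (at t)"
    and kernel: "\<And>s t. (\<Sum>i\<in>I. c i * (m i s * m i t)) = cos (t - s) ^ d" and "d > 0"
  shows "(\<Sum>i\<in>I. c i * (m'' i t)\<^sup>2) = 3 * (real d)\<^sup>2 - 2 * real d"
proof -
  define k where "k s t = real d * real (d - 1) * cos (t - s) ^ (d - 2) - (real d)\<^sup>2 * cos (t - s) ^ d"
    for s t
  \<comment> \<open>Each stage differentiates the finite sum termwise and its closed form
    separately, then equates the two by uniqueness of derivatives.\<close>
  have first: "(\<Sum>i\<in>I. c i * (m i s * m' i t)) = - (real d * cos (t - s) ^ (d - 1) * sin (t - s))" for s t
  proof -
    have "((\<lambda>t. \<Sum>i\<in>I. c i * (m i s * m i t)) has_real_derivative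
        (\<Sum>i\<in>I. c i * (m i s * m' i t))) (at t)"
      by (auto intro!: derivative_eq_intros m' simp: mult_ac)
    then show ?thesis
      unfolding kernel using cos_power_has_derivative DERIV_unique by blast
  qed
  have second: "(\<Sum>i\<in>I. c i * (m'' i t * m i s)) = k t s" for s t
  proof -
    have "((\<lambda>t. \<Sum>i\<in>I. c i * (m i s * m' i t)) has_real_derivative
        (\<Sum>i\<in>I. c i * (m i s * m'' i t))) (at t)"
      by (auto intro!: derivative_eq_intros m'' simp: mult_ac)
    then have "(\<Sum>i\<in>I. c i * (m i s * m'' i t)) = k s t"
      unfolding first k_def using cos_power_second_derivative DERIV_unique by blast
    \<comment> \<open>Symmetry exchanges the roles of the variables: the point already
      differentiated twice is now held fixed, and the other one becomes the free variable.\<close>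
    moreover have "k s t = k t s"
      unfolding k_def using cos_minus[of "t - s"] by simp
    ultimately show ?thesis
      by (simp add: mult.commute)
  qed
  define k' where "k' s t = real d * real (d - 1) * (- (real (d - 2) * cos (t - s) ^ (d - 2 - 1) * sin (t - s)))
      - (real d)\<^sup>2 * (- (real d * cos (t - s) ^ (d - 1) * sin (t - s)))" for s t
  define k'' where "k'' s t = real d * real (d - 1) *
      (real (d - 2) * real (d - 2 - 1) * cos (t - s) ^ (d - 2 - 2) - (real (d - 2))\<^sup>2 * cos (t - s) ^ (d - 2))
      - (real d)\<^sup>2 * (real d * real (d - 1) * cos (t - s) ^ (d - 2) - (real d)\<^sup>2 * cos (t - s) ^ d)" for s t
  have third: "(\<Sum>i\<in>I. c i * (m'' i s * m' i t)) = k' s t" for s t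
  proof -
    have "((\<lambda>t. \<Sum>i\<in>I. c i * (m'' i s * m i t)) has_real_derivative
        (\<Sum>i\<in>I. c i * (m'' i s * m' i t))) (at t)"
      by (auto intro!: derivative_eq_intros m' simp: mult_ac)
    moreover have "(k s has_real_derivative k' s t) (at t)"
      unfolding k_def k'_def by (intro DERIV_diff DERIV_cmult cos_power_has_derivative)
    ultimately show ?thesis
      unfolding second using DERIV_unique by blast
  qed
  have fourth: "(\<Sum>i\<in>I. c i * (m'' i s * m'' i t)) = k'' s t" for s t
  proof -
    have "((\<lambda>t. \<Sum>i\<in>I. c i * (m'' i s * m' i t)) has_real_derivative
        (\<Sum>i\<in>I. c i * (m'' i s * m'' i t))) (at t)"
      by (auto intro!: derivative_eq_intros m'' simp: mult_ac)
    moreover have "(k' s has_real_derivative k'' s t) (at t)"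
      unfolding k'_def k''_def by (intro DERIV_diff DERIV_cmult cos_power_second_derivative)
    ultimately show ?thesis
      unfolding third using DERIV_unique by blast
  qed
  \<comment> \<open>For \<open>d \<ge> 3\<close> the subtractions in \<open>k''\<close> that affect
    the value at \<open>s = t\<close> are genuine; the smaller degrees are evaluated
    directly.\<close>
  consider "d = 1" | "d = 2" | "d \<ge> 3"
    using \<open>d > 0\<close> by linarith
  then have "k'' t t = 3 * (real d)\<^sup>2 - 2 * real d"
    by cases (auto simp: k''_def of_nat_diff algebra_simps power2_eq_square)
  then show ?thesis
    using fourth[of t t] by (simp add: power2_eq_square)
qed

text \<open>At fixed \<open>t\<close> the second derivative is a linear functional of the
  coefficients of \<open>P\<close>. Its dual Bombieri norm is the square root of
  \<open>3 * (real d)\<^sup>2 - 2 * real d\<close>, by the kernel computation, and this is at most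
  the square of \<open>d\<close>.\<close>

lemma second_derivative_on_great_circle:
  fixes x v :: "real ^ 'n::finite"
  assumes P: "P \<in> forms d" and d: "d > 0"
    and orthonormal: "norm x = 1" "norm v = 1" "x \<bullet> v = 0"
  defines "f \<equiv> \<lambda>t. eval_poly P (cos t *\<^sub>R x + sin t *\<^sub>R v)"
  obtains f' f'' where "\<And>t. (f has_real_derivative f' t) (at t)"
    "\<And>t. (f' has_real_derivative f'' t) (at t)" "\<And>t. \<bar>f'' t\<bar> \<le> (real d)\<^sup>2 * bombieri_norm d P"
proof -
  define m where "m \<alpha> t = monomial_value \<alpha> (cos t *\<^sub>R x + sin t *\<^sub>R v)" for \<alpha> t
  let ?p = "Poly_Mapping.lookup P"
  have "\<forall>\<alpha>. \<exists>f' f''. \<forall>t. (m \<alpha> has_real_derivative f' t) (at t) \<and>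
      (f' has_real_derivative f'' t) (at t)"
    using twice_differentiable_monomial_great_circle[of _ x v]
    by (simp add: twice_differentiable_def m_def[abs_def])
  from choice[OF this] obtain m' where "\<forall>\<alpha>. \<exists>f''. \<forall>t.
      (m \<alpha> has_real_derivative m' \<alpha> t) (at t) \<and> (m' \<alpha> has_real_derivative f'' t) (at t)"
    by (elim exE)
  from choice[OF this] obtain m'' where
    m': "\<And>\<alpha> t. (m \<alpha> has_real_derivative m' \<alpha> t) (at t)" and
    m'': "\<And>\<alpha> t. (m' \<alpha> has_real_derivative m'' \<alpha> t) (at t)"
    by blast
  \<comment> \<open>Points at angles \<open>s\<close> and \<open>t\<close> of an orthonormally
    parametrised circle have scalar product \<open>cos (t - s)\<close>.\<close>
  have "(\<Sum>\<alpha>\<in>exponents d. multinomial_coeff d \<alpha> * (m \<alpha> s * m \<alpha> t)) = cos (t - s) ^ d" for s t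
    using orthonormal unfolding m_def reproducing_kernel
    by (simp add: inner_add dot_square_norm inner_commute[of v x] cos_diff mult_ac)
  then have kernel: "(\<Sum>\<alpha>\<in>exponents d. multinomial_coeff d \<alpha> * (m'' \<alpha> t)\<^sup>2) =
      3 * (real d)\<^sup>2 - 2 * real d" for t
    by (rule second_derivative_kernel[where m = m and m' = m', OF m' m'' _ d])
  have "3 * (real d)\<^sup>2 - 2 * real d \<le> ((real d)\<^sup>2)\<^sup>2"
  proof -
    \<comment> \<open>This product is the factorisation of the difference of the two sides.\<close>
    have "0 \<le> real d * ((real d - 1)\<^sup>2 * (real d + 2))" by simp
    then show ?thesis by (simp add: power2_eq_square algebra_simps)
  qed
  then have le: "sqrt (3 * (real d)\<^sup>2 - 2 * real d) \<le> (real d)\<^sup>2"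
    by (intro real_le_lsqrt) simp_all
  show ?thesis
  proof
    show "(f has_real_derivative (\<Sum>\<alpha>\<in>exponents d. ?p \<alpha> * m' \<alpha> t)) (at t)" for t
      unfolding f_def eval_poly_form[OF P] m_def[symmetric]
      by (auto intro!: derivative_eq_intros m' simp: mult.commute)
    show "((\<lambda>t. \<Sum>\<alpha>\<in>exponents d. ?p \<alpha> * m' \<alpha> t) has_real_derivative
        (\<Sum>\<alpha>\<in>exponents d. ?p \<alpha> * m'' \<alpha> t)) (at t)" for t
      by (auto intro!: derivative_eq_intros m'' simp: mult.commute)
    show "\<bar>\<Sum>\<alpha>\<in>exponents d. ?p \<alpha> * m'' \<alpha> t\<bar> \<le> (real d)\<^sup>2 * bombieri_norm d P" for t
      using bombieri_cauchy_schwarz[of P "\<lambda>\<alpha>. m'' \<alpha> t" d]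
        mult_left_mono[OF le bombieri_norm_nonneg[of d P]]
      by (simp add: kernel mult.commute)
  qed
qed

section \<open>Gradient and discriminant\<close>

text \<open>The subtraction of 1 in the exponent truncates only when the factor in front of the
  power is 0.\<close>

definition poly_gradient :: "nat \<Rightarrow> 'n::finite real_mpoly \<Rightarrow> real ^ 'n \<Rightarrow> real ^ 'n" where
  "poly_gradient d P x = (\<chi> i. \<Sum>\<alpha>\<in>exponents d. Poly_Mapping.lookup P \<alpha> *
     (real (Poly_Mapping.lookup \<alpha> i) * (x $ i) ^ (Poly_Mapping.lookup \<alpha> i - 1) *
       (\<Prod>j\<in>UNIV - {i}. (x $ j) ^ Poly_Mapping.lookup \<alpha> j)))"

lemma gderiv_eval_poly:
  assumes P: "P \<in> forms d"
  shows "GDERIV (eval_poly P) x :> poly_gradient d P x"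
proof -
  have coord: "((\<lambda>x. (x $ i) ^ k) has_derivative (\<lambda>h. real k * (x $ i) ^ (k - 1) * h $ i)) (at x)"
    for i and k
    by (auto intro!: derivative_eq_intros bounded_linear.has_derivative[OF bounded_linear_vec_nth] simp: mult_ac)
  have "((\<lambda>x. \<Sum>\<alpha>\<in>exponents d. Poly_Mapping.lookup P \<alpha> * monomial_value \<alpha> x) has_derivative
      (\<lambda>h. \<Sum>\<alpha>\<in>exponents d. Poly_Mapping.lookup P \<alpha> *
        (\<Sum>i\<in>UNIV. real (Poly_Mapping.lookup \<alpha> i) * (x $ i) ^ (Poly_Mapping.lookup \<alpha> i - 1) * h $ i *
          (\<Prod>j\<in>UNIV - {i}. (x $ j) ^ Poly_Mapping.lookup \<alpha> j)))) (at x)"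
    unfolding monomial_value_def
    by (intro has_derivative_sum has_derivative_mult_right has_derivative_prod coord)
  also have "(\<lambda>x. \<Sum>\<alpha>\<in>exponents d. Poly_Mapping.lookup P \<alpha> * monomial_value \<alpha> x) = eval_poly P"
    using eval_poly_form[OF P] by auto
  also have "(\<lambda>h. \<Sum>\<alpha>\<in>exponents d. Poly_Mapping.lookup P \<alpha> *
        (\<Sum>i\<in>UNIV. real (Poly_Mapping.lookup \<alpha> i) * (x $ i) ^ (Poly_Mapping.lookup \<alpha> i - 1) * h $ i *
          (\<Prod>j\<in>UNIV - {i}. (x $ j) ^ Poly_Mapping.lookup \<alpha> j))) = (\<lambda>h. h \<bullet> poly_gradient d P x)"
    unfolding poly_gradient_def inner_vec_def inner_real_def vec_lambda_beta sum_distrib_left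
    by (rule ext, rule trans[OF sum.swap], intro sum.cong refl) (simp only: mult_ac)
  finally show ?thesis
    unfolding gderiv_def .
qed

lemma continuous_on_poly_gradient: "continuous_on S (poly_gradient d P)"
  unfolding poly_gradient_def by (intro continuous_intros)

lemma continuous_on_eval_poly: "continuous_on S (eval_poly P)"
  unfolding eval_poly_def by (intro continuous_intros)

lemma eval_poly_scaleR:
  assumes "P \<in> forms d"
  shows "eval_poly P (r *\<^sub>R x) = r ^ d * eval_poly P x"
proof -
  have "monomial_value \<alpha> (r *\<^sub>R x) = r ^ d * monomial_value \<alpha> x" if "\<alpha> \<in> exponents d" for \<alpha>
    using that
    by (simp add: monomial_value_def exponents_def power_mult_distrib prod.distrib flip: power_sum)
  then show ?thesis
    by (simp add: eval_poly_form[OF assms] sum_distrib_left mult_ac)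
qed

lemma eval_poly_chain:
  assumes P: "P \<in> forms d" and \<gamma>: "(\<gamma> has_vector_derivative v) (at t)"
  shows "((\<lambda>t. eval_poly P (\<gamma> t)) has_real_derivative (v \<bullet> poly_gradient d P (\<gamma> t))) (at t)"
proof -
  have "(eval_poly P has_derivative (\<lambda>h. h \<bullet> poly_gradient d P (\<gamma> t))) (at (\<gamma> t))"
    using gderiv_eval_poly[OF P] unfolding gderiv_def .
  from has_derivative_compose[OF \<gamma>[unfolded has_vector_derivative_def] this]
  show ?thesis
    unfolding has_field_derivative_def by (simp add: mult_commute_abs)
qed

text \<open>Differentiate \<open>eval_poly P (r *\<^sub>R x)\<close> at \<open>r = 1\<close> twice
  over: by the chain rule and by homogeneity.\<close>

lemma euler_identity:
  assumes P: "P \<in> forms d"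
  shows "x \<bullet> poly_gradient d P x = real d * eval_poly P x"
proof -
  have "((\<lambda>r. eval_poly P (r *\<^sub>R x)) has_real_derivative (x \<bullet> poly_gradient d P (1 *\<^sub>R x))) (at 1)"
    by (rule eval_poly_chain[OF P]) (auto intro!: derivative_eq_intros)
  moreover have "((\<lambda>r. eval_poly P (r *\<^sub>R x)) has_real_derivative real d * eval_poly P x) (at 1)"
    unfolding eval_poly_scaleR[OF P] by (auto intro!: derivative_eq_intros)
  ultimately show ?thesis
    using DERIV_unique by fastforce
qed

text \<open>By Euler's identity the subtracted vector is the radial component at a unit vector
  \<open>x\<close>, so this is the gradient of the restriction of \<open>P\<close> to the
  sphere.\<close>

definition tangential_gradient :: "nat \<Rightarrow> 'n::finite real_mpoly \<Rightarrow> real ^ 'n \<Rightarrow> real ^ 'n" where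
  "tangential_gradient d P x = poly_gradient d P x - (real d * eval_poly P x) *\<^sub>R x"

lemma tangential_gradient_orthogonal:
  assumes "P \<in> forms d" "norm x = 1"
  shows "x \<bullet> tangential_gradient d P x = 0"
  using assms by (simp add: tangential_gradient_def inner_diff_right euler_identity dot_square_norm)

lemma dist_discriminant_le:
  assumes "Q \<in> real_discriminant d"
  shows "dist_discriminant d P \<le> bombieri_norm d (P - Q)"
  unfolding dist_discriminant_def
  using assms bombieri_norm_nonneg by (intro cINF_lower bdd_belowI[of _ 0]) auto

lemma dist_discriminant_nonneg: "dist_discriminant d P \<ge> 0"
  unfolding dist_discriminant_def
  using zero_in_real_discriminant bombieri_norm_nonneg by (intro cINF_greatest) auto

text \<open>At a critical point the full gradient is
  \<open>(real d * eval_poly P z) *\<^sub>R z\<close>, which is also the gradient at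
  \<open>z\<close> of the power form \<open>R\<close>; the values at \<open>z\<close> agree too.
  Hence \<open>P - R\<close> is singular at \<open>z\<close>, and its distance from \<open>P\<close>
  is the norm of \<open>R\<close>.\<close>

lemma dist_discriminant_le_critical_value:
  fixes P :: "'n::finite real_mpoly"
  assumes P: "P \<in> forms d" and z: "norm z = 1" and critical: "tangential_gradient d P z = 0"
  shows "dist_discriminant d P \<le> \<bar>eval_poly P z\<bar>"
proof -
  define R where "R = power_form d (eval_poly P z) z"
  have R: "R \<in> forms d"
    by (simp add: R_def power_form_in_forms)
  have "GDERIV (eval_poly R) z :> poly_gradient d P z"
  proof -
    have "((\<lambda>x. eval_poly P z * (z \<bullet> x) ^ d) has_derivative
        (\<lambda>h. eval_poly P z * (real d * (z \<bullet> h) * (z \<bullet> z) ^ (d - 1)))) (at z)"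
      by (auto intro!: derivative_eq_intros)
    also have "(\<lambda>h. eval_poly P z * (real d * (z \<bullet> h) * (z \<bullet> z) ^ (d - 1))) =
        (\<lambda>h. h \<bullet> poly_gradient d P z)"
      using critical z by (simp add: tangential_gradient_def dot_square_norm inner_commute mult_ac)
    finally show ?thesis
      unfolding gderiv_def R_def eval_power_form .
  qed
  from GDERIV_diff[OF gderiv_eval_poly[OF P] this]
  have "GDERIV (eval_poly (P - R)) z :> 0"
    by (simp add: eval_poly_diff[OF P R, abs_def])
  moreover have "eval_poly (P - R) z = 0"
    using z unfolding eval_poly_diff[OF P R] by (simp add: R_def eval_power_form dot_square_norm)
  ultimately have "P - R \<in> real_discriminant d"
    using z forms_diff[OF P R] by (auto simp: real_discriminant_def)
  from dist_discriminant_le[OF this, of P] show ?thesis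
    using z by (simp add: R_def bombieri_norm_power_form)
qed

section \<open>The descent map\<close>

lemma compact_sphere_sublevel:
  "compact {z \<in> sphere 0 1. \<bar>eval_poly P z\<bar> \<le> M}"
proof -
  have "closedin (top_of_set (sphere 0 1)) (sphere 0 1 \<inter> eval_poly P -` {-M..M})"
    by (intro continuous_closedin_preimage continuous_on_eval_poly closed_atLeastAtMost)
  then have "compact (sphere 0 1 \<inter> eval_poly P -` {-M..M})"
    by (rule closedin_compact[OF compact_sphere])
  also have "sphere 0 1 \<inter> eval_poly P -` {-M..M} = {z \<in> sphere 0 1. \<bar>eval_poly P z\<bar> \<le> M}"
    by auto
  finally show ?thesis .
qed

text \<open>Follow the great circle in the direction of the tangential gradient for the signed
  length \<open>- h * eval_poly P z\<close>. To first order the value is multiplied by 1 minus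
  \<open>h\<close> times the gradient norm; for small \<open>h\<close> the second-order error uses
  up at most half of the guaranteed gain.\<close>

lemma descent_map:
  fixes P :: "'n::finite real_mpoly" and M :: real
  assumes P: "P \<in> forms d" and d: "d > 0"
  defines "K \<equiv> {z \<in> sphere 0 1. \<bar>eval_poly P z\<bar> \<le> M}"
  assumes regular: "\<And>z. z \<in> K \<Longrightarrow> tangential_gradient d P z \<noteq> 0"
  obtains \<phi> q where "continuous_on K \<phi>" "\<phi> ` K \<subseteq> K" "0 \<le> q" "q < 1"
    "\<And>z. z \<in> K \<Longrightarrow> eval_poly P z = 0 \<Longrightarrow> \<phi> z = z"
    "\<And>z. z \<in> K \<Longrightarrow> \<bar>eval_poly P (\<phi> z)\<bar> \<le> q * \<bar>eval_poly P z\<bar>"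
proof (cases "K = {}")
  case True
  then show ?thesis
    using that[of id 0] by simp
next
  case False
  let ?p = "eval_poly P" and ?g = "tangential_gradient d P"
  have K_compact: "compact K"
    unfolding K_def by (rule compact_sphere_sublevel)
  have cont_g: "continuous_on K ?g"
    unfolding tangential_gradient_def
    by (intro continuous_intros continuous_on_poly_gradient continuous_on_eval_poly)
  obtain z0 where "z0 \<in> K" and z0: "\<And>z. z \<in> K \<Longrightarrow> norm (?g z0) \<le> norm (?g z)"
    using continuous_attains_inf[OF K_compact False continuous_on_norm[OF cont_g]] by blast
  obtain z1 where "z1 \<in> K" and z1: "\<And>z. z \<in> K \<Longrightarrow> norm (?g z) \<le> norm (?g z1)"
    using continuous_attains_sup[OF K_compact False continuous_on_norm[OF cont_g]] by blast
  define c where "c = norm (?g z0)"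
  define B where "B = norm (?g z1)"
  define N where "N = (real d)\<^sup>2 * bombieri_norm d P"
  \<comment> \<open>The bound \<open>1 / B\<close> keeps the first-order factor nonnegative, and the
    other bound controls the quadratic error. The added 1 avoids a zero denominator.\<close>
  define h where "h = min (1 / B) (c / (N * M + 1))"
  \<comment> \<open>The first-order gain is at least \<open>h * c\<close>, and half of it is given
    up to the error.\<close>
  define q where "q = 1 - h * c / 2"
  have "c > 0" "B > 0"
    using regular \<open>z0 \<in> K\<close> \<open>z1 \<in> K\<close> by (auto simp: c_def B_def)
  have "M \<ge> 0"
    using \<open>z0 \<in> K\<close> by (auto simp: K_def)
  have "N \<ge> 0"
    by (simp add: N_def bombieri_norm_nonneg)
  then have "N * M \<ge> 0"
    using \<open>M \<ge> 0\<close> by simp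
  then have "h > 0"
    using \<open>c > 0\<close> \<open>B > 0\<close> by (simp add: h_def)
  have "h \<le> 1 / B" "h \<le> c / (N * M + 1)"
    by (simp_all add: h_def)
  then have hB: "h * B \<le> 1" and "h * (N * M + 1) \<le> c"
    using \<open>B > 0\<close> \<open>N * M \<ge> 0\<close> by (simp_all add: pos_le_divide_eq)
  then have hN: "h * (N * M) \<le> c"
    using \<open>h > 0\<close> by (simp add: algebra_simps)
  have "c \<le> B"
    using z0 \<open>z1 \<in> K\<close> by (simp add: c_def B_def)
  then have "h * c \<le> 1"
    using hB mult_left_mono[of c B h] \<open>h > 0\<close> by linarith
  then have q: "0 \<le> q" "q < 1"
    using \<open>h > 0\<close> \<open>c > 0\<close> by (auto simp: q_def)
  define u where "u z = ?g z /\<^sub>R norm (?g z)" for z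
  \<comment> \<open>The arc has length 0 at zeros of \<open>P\<close>, which are therefore
    fixed.\<close>
  define \<phi> where "\<phi> z = cos (- h * ?p z) *\<^sub>R z + sin (- h * ?p z) *\<^sub>R u z" for z
  have u: "norm (u z) = 1" "z \<bullet> u z = 0" and z: "norm z = 1" if "z \<in> K" for z
    using that regular[OF that] tangential_gradient_orthogonal[OF P, of z]
    by (auto simp: u_def K_def)
  have contract: "\<bar>?p (\<phi> z)\<bar> \<le> q * \<bar>?p z\<bar>" if zK: "z \<in> K" for z
  proof -
    define f where "f t = ?p (cos t *\<^sub>R z + sin t *\<^sub>R u z)" for t
    define G where "G = norm (?g z)"
    have G: "c \<le> G" "G \<le> B"
      using z0 z1 zK by (auto simp: c_def B_def G_def)
    obtain f' f'' where f': "\<And>t. (f has_real_derivative f' t) (at t)"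
      and f'': "\<And>t. (f' has_real_derivative f'' t) (at t)" and f''_bound: "\<And>t. \<bar>f'' t\<bar> \<le> N"
      using second_derivative_on_great_circle[OF P d z[OF zK] u[OF zK]]
      unfolding f_def[symmetric] N_def[symmetric] by blast
    have "((\<lambda>t. cos t *\<^sub>R z + sin t *\<^sub>R u z) has_vector_derivative u z) (at 0)"
      by (auto intro!: derivative_eq_intros)
    from eval_poly_chain[OF P this]
    have "(f has_real_derivative (u z \<bullet> poly_gradient d P z)) (at 0)"
      by (simp add: f_def[abs_def])
    then have "f' 0 = u z \<bullet> poly_gradient d P z"
      using f' DERIV_unique by blast
    \<comment> \<open>The radial part of the gradient is orthogonal to \<open>u z\<close>.\<close>
    also have "\<dots> = u z \<bullet> ?g z"
      using u(2)[OF zK] by (simp add: tangential_gradient_def inner_diff_right inner_commute)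
    also have "\<dots> = G"
      using regular[OF zK] by (simp add: u_def G_def dot_square_norm power2_eq_square)
    finally have f'0: "f' 0 = G" .
    have f0: "f 0 = ?p z"
      by (simp add: f_def)
    have "\<bar>f (- h * ?p z) - (1 - h * G) * ?p z\<bar> \<le> N * (h * ?p z)\<^sup>2 / 2"
      using linear_approximation_bound[OF f' f'' f''_bound, of "- h * ?p z"]
      by (simp add: f'0 f0 algebra_simps)
    \<comment> \<open>One factor \<open>\<bar>?p z\<bar>\<close> is split off to be bounded by
      \<open>M\<close>, which turns the quadratic error into a linear one.\<close>
    also have "N * (h * ?p z)\<^sup>2 / 2 = h * \<bar>?p z\<bar> / 2 * (h * (N * \<bar>?p z\<bar>))"
      by (simp add: power2_eq_square)
    also have "\<dots> \<le> h * \<bar>?p z\<bar> / 2 * c"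
    proof (rule mult_left_mono)
      have "h * (N * \<bar>?p z\<bar>) \<le> h * (N * M)"
        using zK \<open>h > 0\<close> \<open>N \<ge> 0\<close> by (intro mult_left_mono) (auto simp: K_def)
      then show "h * (N * \<bar>?p z\<bar>) \<le> c"
        using hN by linarith
    qed (use \<open>h > 0\<close> in simp)
    finally have "\<bar>f (- h * ?p z)\<bar> \<le> \<bar>(1 - h * G) * ?p z\<bar> + h * \<bar>?p z\<bar> / 2 * c"
      by linarith
    also have "\<bar>1 - h * G\<bar> \<le> 1 - h * c"
      using mult_left_mono[OF G(1), of h] mult_left_mono[OF G(2), of h] hB \<open>h > 0\<close> by linarith
    then have "\<bar>(1 - h * G) * ?p z\<bar> \<le> (1 - h * c) * \<bar>?p z\<bar>"
      unfolding abs_mult by (rule mult_right_mono) simp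
    finally show ?thesis
      by (simp add: f_def \<phi>_def q_def algebra_simps)
  qed
  show ?thesis
  proof
    show "continuous_on K \<phi>"
      unfolding \<phi>_def u_def using regular
      by (intro continuous_intros continuous_on_eval_poly cont_g) auto
    show "\<phi> ` K \<subseteq> K"
    proof clarify
      fix z assume zK: "z \<in> K"
      have "\<bar>?p (\<phi> z)\<bar> \<le> 1 * \<bar>?p z\<bar>"
        using contract[OF zK] q mult_right_mono[of q 1 "\<bar>?p z\<bar>"] by linarith
      moreover have "norm (\<phi> z) = 1"
        unfolding \<phi>_def using z u zK by (intro norm_great_circle) auto
      ultimately show "\<phi> z \<in> K"
        using zK by (auto simp: K_def)
    qed
    show "\<phi> z = z" if "?p z = 0" for z
      using that by (simp add: \<phi>_def)
  qed (fact q contract)+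
qed

section \<open>Joining close zeros within one component\<close>

lemma zeros_joined_below_discriminant_distance:
  fixes P :: "'n::finite real_mpoly"
  assumes P: "P \<in> forms d" and d: "d > 0" and M: "M < dist_discriminant d P"
    and S: "connected S" "S \<subseteq> {z \<in> sphere 0 1. \<bar>eval_poly P z\<bar> \<le> M}" "x \<in> S" "y \<in> S"
    and zeros: "eval_poly P x = 0" "eval_poly P y = 0"
  obtains T where "connected T" "T \<subseteq> zero_level P" "x \<in> T" "y \<in> T"
proof -
  define K where "K = {z \<in> sphere 0 1. \<bar>eval_poly P z\<bar> \<le> M}"
  \<comment> \<open>A critical point in \<open>K\<close> would put the discriminant within distance
    \<open>M\<close> of \<open>P\<close>.\<close>
  have "tangential_gradient d P z \<noteq> 0" if "z \<in> K" for z
    using that M dist_discriminant_le_critical_value[OF P, of z] by (auto simp: K_def)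
  then obtain \<phi> q where \<phi>: "continuous_on K \<phi>" "\<phi> ` K \<subseteq> K"
    and q: "0 \<le> q" "q < 1" and fixed: "\<And>z. z \<in> K \<Longrightarrow> eval_poly P z = 0 \<Longrightarrow> \<phi> z = z"
    and contract: "\<And>z. z \<in> K \<Longrightarrow> \<bar>eval_poly P (\<phi> z)\<bar> \<le> q * \<bar>eval_poly P z\<bar>"
    using descent_map[OF P d, of M] unfolding K_def by blast
  have "compact K"
    unfolding K_def by (rule compact_sphere_sublevel)
  then obtain T where "connected T" "T \<subseteq> {z \<in> K. eval_poly P z = 0}" "x \<in> T" "y \<in> T"
    using contracting_map_joins_zeros[OF _ continuous_on_eval_poly \<phi> fixed contract q
        S(1) S(2)[folded K_def] S(3,4) zeros] by blast
  then show ?thesis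
    by (intro that[of T]) (auto simp: K_def zero_level_def)
qed

text \<open>The bound in \<open>close\<close> is the arc length at which the estimate
  \<open>(real d)\<^sup>2 * N * \<theta>\<^sup>2 / 8\<close> along the arc reaches the distance to
  the discriminant; below it the estimate is strictly smaller.\<close>

lemma close_zeros_joined:
  fixes P :: "'n::finite real_mpoly"
  assumes n: "CARD('n) > 1" and d: "d > 0" and P: "P \<in> forms d"
    and x: "x \<in> zero_level P" and y: "y \<in> zero_level P"
    and close: "sphere_dist x y < 2 / real d * sqrt (2 * dist_discriminant d P / bombieri_norm d P)"
  obtains T where "connected T" "T \<subseteq> zero_level P" "x \<in> T" "y \<in> T"
proof -
  define \<theta> where "\<theta> = sphere_dist x y"
  define \<delta> where "\<delta> = dist_discriminant d P"
  define N where "N = bombieri_norm d P"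
  have x': "norm x = 1" "eval_poly P x = 0" and y': "norm y = 1" "eval_poly P y = 0"
    using x y by (auto simp: zero_level_def)
  have "0 \<le> \<theta>"
    using Cauchy_Schwarz_ineq2[of x y] x' y' by (simp add: \<theta>_def sphere_dist_def arccos_lbound abs_le_iff)
  \<comment> \<open>Division by zero yields 0, so a vanishing norm would make the right-hand side of
    \<open>close\<close> equal to 0, against \<open>0 \<le> \<theta>\<close>.\<close>
  have "N \<noteq> 0"
    using close \<open>0 \<le> \<theta>\<close> by (auto simp: N_def \<theta>_def)
  then have "N > 0"
    using bombieri_norm_nonneg[of d P] by (simp add: N_def)
  have "0 \<le> 2 * \<delta> / N"
    using \<open>N > 0\<close> dist_discriminant_nonneg[of d P] by (simp add: \<delta>_def)
  have "\<theta>\<^sup>2 < (2 / real d * sqrt (2 * \<delta> / N))\<^sup>2"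
    using close \<open>0 \<le> \<theta>\<close> by (intro power_strict_mono) (auto simp: \<theta>_def \<delta>_def N_def)
  also have "\<dots> = 4 / (real d)\<^sup>2 * (2 * \<delta> / N)"
    using \<open>0 \<le> 2 * \<delta> / N\<close> by (simp only: power_mult_distrib power_divide real_sqrt_pow2) simp
  finally have small: "(real d)\<^sup>2 * N * \<theta>\<^sup>2 / 8 < \<delta>"
    using d \<open>N > 0\<close> by (simp add: field_simps)
  obtain v where v: "norm v = 1" "x \<bullet> v = 0" and y_eq: "y = cos \<theta> *\<^sub>R x + sin \<theta> *\<^sub>R v"
    using great_circle_through[of x y] n x' y' unfolding \<theta>_def by auto
  define \<gamma> where "\<gamma> t = cos t *\<^sub>R x + sin t *\<^sub>R v" for t
  obtain f' f'' where f: "\<And>t. ((\<lambda>t. eval_poly P (\<gamma> t)) has_real_derivative f' t) (at t)"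
    "\<And>t. (f' has_real_derivative f'' t) (at t)" "\<And>t. \<bar>f'' t\<bar> \<le> (real d)\<^sup>2 * N"
    using second_derivative_on_great_circle[OF P d x'(1) v] unfolding \<gamma>_def[symmetric] N_def by blast
  have "\<bar>eval_poly P (\<gamma> t)\<bar> \<le> (real d)\<^sup>2 * N * \<theta>\<^sup>2 / 8" if "t \<in> {0..\<theta>}" for t
    using f by (rule vanishing_at_endpoints_bound) (use that x' y' y_eq in \<open>auto simp: \<gamma>_def\<close>)
  then have "\<gamma> ` {0..\<theta>} \<subseteq> {z \<in> sphere 0 1. \<bar>eval_poly P z\<bar> \<le> (real d)\<^sup>2 * N * \<theta>\<^sup>2 / 8}"
    using norm_great_circle[OF x'(1) v] by (auto simp: \<gamma>_def)
  moreover have "connected (\<gamma> ` {0..\<theta>})"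
    unfolding \<gamma>_def by (intro connected_continuous_image continuous_intros connected_Icc)
  moreover have "x \<in> \<gamma> ` {0..\<theta>}" "y \<in> \<gamma> ` {0..\<theta>}"
    using \<open>0 \<le> \<theta>\<close> y_eq by (auto simp: \<gamma>_def image_iff intro: bexI[of _ 0] bexI[of _ \<theta>])
  ultimately show ?thesis
    using zeros_joined_below_discriminant_distance[OF P d small[unfolded \<delta>_def]] x'(2) y'(2) that
    by blast
qed

theorem theorem10p3:
  fixes P :: "'n::finite real_mpoly" and d :: nat and C D :: "(real ^ 'n) set"
  assumes "CARD('n) > 1" and "d > 1"
    and "P \<in> forms d"
    and "dist_discriminant d P \<noteq> 0"
    and "C \<in> components (zero_level P)" and "D \<in> components (zero_level P)" and "C \<noteq> D"
  shows "sphere_setdist C D \<ge>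
    2 / real d * sqrt (2 * dist_discriminant d P / bombieri_norm d P)"
  unfolding sphere_setdist_def
proof (rule cINF_greatest)
  show "C \<times> D \<noteq> {}"
    using assms in_components_nonempty by auto
next
  fix u assume "u \<in> C \<times> D"
  then obtain x y where u: "u = (x, y)" and xy: "x \<in> C" "y \<in> D"
    by auto
  have "\<not> sphere_dist x y < 2 / real d * sqrt (2 * dist_discriminant d P / bombieri_norm d P)"
  proof
    assume "sphere_dist x y < 2 / real d * sqrt (2 * dist_discriminant d P / bombieri_norm d P)"
    moreover have "x \<in> zero_level P" "y \<in> zero_level P"
      using assms xy in_components_subset by blast+
    ultimately obtain T where T: "connected T" "T \<subseteq> zero_level P" "x \<in> T" "y \<in> T"
      using close_zeros_joined[of d P x y] assms by auto
    \<comment> \<open>\<open>T\<close> meets \<open>C\<close> in \<open>x\<close>, so the component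
      \<open>C\<close> absorbs it. Then \<open>y\<close> lies in both \<open>C\<close> and
      \<open>D\<close>, which forces the components to coincide.\<close>
    have "T \<subseteq> C"
      using T xy by (intro components_maximal[OF assms(5)]) auto
    then have "C \<inter> D \<noteq> {}"
      using T xy by auto
    then show False
      using components_eq[of C _ D] assms by blast
  qed
  then show "2 / real d * sqrt (2 * dist_discriminant d P / bombieri_norm d P) \<le>
      (case u of (x, y) \<Rightarrow> sphere_dist x y)"
    by (simp add: u)
qed

end
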